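(* Let $(X,d,\ll,\leq,\tau)$ be a strongly causal Lorentzian length space that has property $(TC)$. Then $(X,d,\ll,\leq,\tau)$ is inextendible as a regular Lorentzian length space, i.e., there is no regular Lorentzian length space $(\tilde X,\tilde d,\tilde\ll,\tilde\leq,\tilde\tau)$ that is an extension of $(X,d,\ll,\leq,\tau)$.
   Context: **Lorentzian pre-length spaces.** A causal space is a set $X$ with a preorder $\leq$ and a transitive relation $\ll$ contained in $\leq$. Write $x<y$ if $x\leq y$ and $x\neq y$. Put $I^+(x)=\{y: x\ll y\}$, $I^-(x)=\{y:y\ll x\}$, $J^+(x)=\{y:x\leq y\}$, $J^-(x)=\{y:y\le x\}$. If $X$ also carries a metric $d$ and a lower semicontinuous map $\tau\colon X\times X\to[0,\infty]$ with $\tau(x,z)\geq\tau(x,y)+\tau(y,z)$ for all $x\le y\le z$, $\tau(x,y)=0$ if $x\nleq y$, and $\tau(x,y)>0\Leftrightarrow x\ll y$, then $(X,d,\ll,\leq,\tau)$ is a Lorentzian pre-length space. **Curves and length.** A non-constant curve $\gamma\colon I\to X$ ($I$ an interval) is future-directed causal (timelike) if it is locally Lipschitz continuous with respect to $d$ and $\gamma(t_1)\leq\gamma(t_2)$ ($\gamma(t_1)\ll\gamma(t_2)$) for all $t_1<t_2$ in $I$; past-directed curves are defined with the relations reversed. A causal curve is null if no two of its points are related by $\ll$. For $\gamma\colon[a,b]\to X$ future-directed causal, $L_\tau(\gamma):=\inf\{\sum_{i=0}^{N-1}\tau(\gamma(t_i),\gamma(t_{i+1})) : a=t_0<t_1<\dots<t_N=b,\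 N\in\mathbb N\}$; if the interval is $[a,b)$ one uses partitions with $a=t_0<\dots<t_N<b$, and similarly in the other cases. **Localisability.** $X$ is localisable (localising) if every $x\in X$ has an open, so-called localising, neighbourhood $\Omega_x$ such that: (i) the $d$-length of all causal curves contained in $\Omega_x$ is uniformly bounded; (ii) there is a continuous map $\omega_x\colon\Omega_x\times\Omega_x\to[0,\infty)$ (the local time separation function) such that $\Omega_x$ with the restrictions of $d,\ll,\leq$ and with $\omega_x$ is a Lorentzian pre-length space, and $I^\pm(y)\cap\Omega_x\neq\emptyset$ for every $y\in\Omega_x$; (iii) for all $p,q\in\Omega_x$ with $p<q$ there is a future-directed causal curve $\gamma_{p,q}$ from $p$ to $q$ that is maximal in $\Omega_x$ (has maximal $L_\tau$ among future-directed causal curves in $\Omega_x$ from $p$ to $q$) and satisfies $L_\tau(\gamma_{p,q})=\omega_x(p,q)\leq\tau(p,q)$. It is regularly localisable if in addition the $\Omega_x$ can be chosen such that (iv) whenever $p,q\in\Omega_x$ satisfy $p\ll q$, then $\gamma_{p,q}$ is timelike and strictly longer than any future-directed causal curve in $\Omega_x$ from $p$ to $q$ that contains a null segment. **Lorentzian length spaces.** $X$ is causally path connected if for $x\ll y$ (resp. $x<y$) there is a future-directed timelike (resp. causal) curve from $x$ to $y$. $X$ is locally causally closed if every point has a neighbourhood $U$ such that $\leq$ is closed in $\bar U\times\bar U$. Let $\mathcal T(x,y):=\sup\{L_\tau(\gamma):\gamma\text{ future-directed causal from }x\text{ to }y\}$ if such curves exist, and $\mathcal T(x,y):=0$ otherwise.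 A Lorentzian length space is a locally causally closed, causally path connected, localisable Lorentzian pre-length space with $\tau=\mathcal T$; it is regular if it is in addition regularly localisable. It is strongly causal if the topology with subbase $\{I^+(x)\cap I^-(y):x,y\in X\}$ equals the topology induced by $d$. **Geodesics and $(TC)$.** In a localising Lorentzian pre-length space a future-directed causal curve $\gamma\colon I\to X$ is a geodesic if for every $t_0\in I$ there are a localising neighbourhood $\Omega$ of $\gamma(t_0)$ (with local time separation function $\omega$) and a neighbourhood $J=[c,d]$ of $t_0$ in $I$ such that $\gamma|_J$ is maximal in $\Omega$ from $\gamma(c)$ to $\gamma(d)$, i.e. $L_\tau(\gamma|_{[c,d]})=\omega(\gamma(c),\gamma(d))$. A timelike geodesic is a geodesic that is a timelike curve. A future-directed geodesic $\gamma\colon[a,b)\to X$ is extendible as a geodesic if there is a future-directed geodesic $\bar\gamma\colon[a,b]\to X$ with $\bar\gamma|_{[a,b)}=\gamma$; otherwise it is inextendible as a geodesic (analogously towards the past). $X$ has property $(TC)$ if all inextendible timelike geodesics have infinite $\tau$-length. **Extensions.** A Lorentzian pre-length space $(\tilde X,\tilde d,\tilde\ll,\tilde\leq,\tilde\tau)$ is an extension of $(X,d,\ll,\leq,\tau)$ if: (i) $(\tilde X,\tilde d)$ is connected; (ii) there is an isometry $\iota\colon(X,d)\to(\tilde X,\tilde d)$ of metric spaces (not required to be onto); (iii) $\iota(X)$ is a proper, open subset of $\tilde X$; (iv) $x\leq y\Rightarrow\iota(x)\,\tilde\leq\,\iota(y)$ and $x\ll y\Rightarrow\iota(x)\,\tilde\ll\,\iota(y)$;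 (v) a curve $\gamma\colon I\to X$ is timelike (resp. causal) if and only if $\iota\circ\gamma$ is timelike (resp. causal) in $\tilde X$, and $L_\tau(\gamma)=L_{\tilde\tau}(\iota\circ\gamma)$ for every causal curve $\gamma\colon I\to X$. *)

theory Defs
  imports "HOL-Analysis.Analysis"
begin

text \<open>Spaces are given by an explicit carrier, so that a subset with the restricted structure is
  again a space. The values of the other fields off the carrier carry no meaning.\<close>

record 'a lorentzian_structure =
  points :: "'a set"
  distance :: "'a \<Rightarrow> 'a \<Rightarrow> real"
  chron :: "'a \<Rightarrow> 'a \<Rightarrow> bool"
  causal :: "'a \<Rightarrow> 'a \<Rightarrow> bool"
  time_sep :: "'a \<Rightarrow> 'a \<Rightarrow> ennreal"

abbreviation top_of :: "'a lorentzian_structure \<Rightarrow> 'a topology" where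
  "top_of X \<equiv> Metric_space.mtopology (points X) (distance X)"

definition chron_future :: "'a lorentzian_structure \<Rightarrow> 'a \<Rightarrow> 'a set" where
  "chron_future X x = {y \<in> points X. chron X x y}"

definition chron_past :: "'a lorentzian_structure \<Rightarrow> 'a \<Rightarrow> 'a set" where
  "chron_past X x = {y \<in> points X. chron X y x}"

definition causal_space :: "'a lorentzian_structure \<Rightarrow> bool" where
  "causal_space X \<longleftrightarrow>
     reflp_on (points X) (causal X) \<and> transp_on (points X) (causal X) \<and>
     transp_on (points X) (chron X) \<and>
     (\<forall>x\<in>points X. \<forall>y\<in>points X. chron X x y \<longrightarrow> causal X x y)"

definition lower_semicontinuous_map :: "'a topology \<Rightarrow> ('a \<Rightarrow> ennreal) \<Rightarrow> bool" where
  "lower_semicontinuous_map T f \<longleftrightarrow> (\<forall>c. openin T {x \<in> topspace T. c < f x})"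

definition lorentzian_pre_length_space :: "'a lorentzian_structure \<Rightarrow> bool" where
  "lorentzian_pre_length_space X \<longleftrightarrow>
     causal_space X \<and>
     Metric_space (points X) (distance X) \<and>
     lower_semicontinuous_map (prod_topology (top_of X) (top_of X)) (\<lambda>(x, y). time_sep X x y) \<and>
     (\<forall>x\<in>points X. \<forall>y\<in>points X. \<forall>z\<in>points X.
        causal X x y \<and> causal X y z \<longrightarrow> time_sep X x y + time_sep X y z \<le> time_sep X x z) \<and>
     (\<forall>x\<in>points X. \<forall>y\<in>points X. \<not> causal X x y \<longrightarrow> time_sep X x y = 0) \<and>
     (\<forall>x\<in>points X. \<forall>y\<in>points X. 0 < time_sep X x y \<longleftrightarrow> chron X x y)"


section \<open>Curves\<close>

definition locally_lipschitz_curve ::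
    "'a lorentzian_structure \<Rightarrow> real set \<Rightarrow> (real \<Rightarrow> 'a) \<Rightarrow> bool" where
  "locally_lipschitz_curve X I \<gamma> \<longleftrightarrow>
     (\<forall>t\<in>I. \<exists>e>0. \<exists>L. \<forall>r\<in>I \<inter> ball t e. \<forall>s\<in>I \<inter> ball t e.
        distance X (\<gamma> r) (\<gamma> s) \<le> L * \<bar>r - s\<bar>)"

text \<open>Locally Lipschitz, non-constant curves whose points are related by \<open>R\<close> in increasing order
  of the parameter.\<close>

definition directed_curve :: "'a lorentzian_structure \<Rightarrow> ('a \<Rightarrow> 'a \<Rightarrow> bool) \<Rightarrow>
    real set \<Rightarrow> (real \<Rightarrow> 'a) \<Rightarrow> bool" where
  "directed_curve X R I \<gamma> \<longleftrightarrow>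
     is_interval I \<and> \<gamma> ` I \<subseteq> points X \<and> (\<exists>s\<in>I. \<exists>t\<in>I. \<gamma> s \<noteq> \<gamma> t) \<and>
     locally_lipschitz_curve X I \<gamma> \<and>
     (\<forall>s\<in>I. \<forall>t\<in>I. s < t \<longrightarrow> R (\<gamma> s) (\<gamma> t))"

abbreviation future_causal where "future_causal X \<equiv> directed_curve X (causal X)"
abbreviation past_causal where "past_causal X \<equiv> directed_curve X (\<lambda>x y. causal X y x)"
abbreviation future_timelike where "future_timelike X \<equiv> directed_curve X (chron X)"
abbreviation past_timelike where "past_timelike X \<equiv> directed_curve X (\<lambda>x y. chron X y x)"

definition causal_curve :: "'a lorentzian_structure \<Rightarrow> real set \<Rightarrow> (real \<Rightarrow> 'a) \<Rightarrow> bool" where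
  "causal_curve X I \<gamma> \<longleftrightarrow> future_causal X I \<gamma> \<or> past_causal X I \<gamma>"

definition timelike_curve :: "'a lorentzian_structure \<Rightarrow> real set \<Rightarrow> (real \<Rightarrow> 'a) \<Rightarrow> bool" where
  "timelike_curve X I \<gamma> \<longleftrightarrow> future_timelike X I \<gamma> \<or> past_timelike X I \<gamma>"

definition null_curve :: "'a lorentzian_structure \<Rightarrow> real set \<Rightarrow> (real \<Rightarrow> 'a) \<Rightarrow> bool" where
  "null_curve X I \<gamma> \<longleftrightarrow> causal_curve X I \<gamma> \<and> (\<forall>s\<in>I. \<forall>t\<in>I. \<not> chron X (\<gamma> s) (\<gamma> t))"

definition contains_null_segment ::
    "'a lorentzian_structure \<Rightarrow> real set \<Rightarrow> (real \<Rightarrow> 'a) \<Rightarrow> bool" where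
  "contains_null_segment X I \<gamma> \<longleftrightarrow> (\<exists>s t. s < t \<and> {s..t} \<subseteq> I \<and> null_curve X {s..t} \<gamma>)"


section \<open>Lengths\<close>

definition partitions :: "real \<Rightarrow> real \<Rightarrow> (nat \<times> (nat \<Rightarrow> real)) set" where
  "partitions a b = {(N, t). t 0 = a \<and> t N = b \<and> (\<forall>i<N. t i < t (Suc i))}"

definition d_length :: "'a lorentzian_structure \<Rightarrow> real set \<Rightarrow> (real \<Rightarrow> 'a) \<Rightarrow> ennreal" where
  "d_length X I \<gamma> =
     (SUP (N, t) \<in> {(N, t). (\<forall>i\<le>N. t i \<in> I) \<and> (\<forall>i<N. t i < t (Suc i))}.
        \<Sum>i<N. ennreal (distance X (\<gamma> (t i)) (\<gamma> (t (Suc i)))))"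

definition tau_length_on ::
    "'a lorentzian_structure \<Rightarrow> real \<Rightarrow> real \<Rightarrow> (real \<Rightarrow> 'a) \<Rightarrow> ennreal" where
  "tau_length_on X a b \<gamma> =
     (INF (N, t) \<in> partitions a b. \<Sum>i<N. time_sep X (\<gamma> (t i)) (\<gamma> (t (Suc i))))"

text \<open>On an interval that is not compact the length is the limit of the lengths of the compact
  pieces that exhaust it. A plain infimum over all partitions \<open>a = t\<^sub>0 < \<dots> < t\<^sub>N < b\<close> with
  varying \<open>t\<^sub>N\<close> is governed by one-step partitions near \<open>a\<close> and is zero for every curve in Minkowski space; it is
  never larger than the length used here (see \<open>property_TC_if_literal\<close> below).\<close>

definition tau_length :: "'a lorentzian_structure \<Rightarrow> real set \<Rightarrow> (real \<Rightarrow> 'a) \<Rightarrow> ennreal" where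
  "tau_length X I \<gamma> =
     (if compact I then tau_length_on X (Inf I) (Sup I) \<gamma>
      else SUP (a, b) \<in> {(a, b). a \<in> I \<and> b \<in> I \<and> a < b}. tau_length_on X a b \<gamma>)"


section \<open>Localisability\<close>

definition causal_path_in :: "'a lorentzian_structure \<Rightarrow> 'a set \<Rightarrow> 'a \<Rightarrow> 'a \<Rightarrow>
    real \<Rightarrow> real \<Rightarrow> (real \<Rightarrow> 'a) \<Rightarrow> bool" where
  "causal_path_in X U p q a b \<gamma> \<longleftrightarrow>
     future_causal X {a..b} \<gamma> \<and> \<gamma> ` {a..b} \<subseteq> U \<and> \<gamma> a = p \<and> \<gamma> b = q"

definition maximal_in :: "'a lorentzian_structure \<Rightarrow> 'a set \<Rightarrow> 'a \<Rightarrow> 'a \<Rightarrow>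
    real \<Rightarrow> real \<Rightarrow> (real \<Rightarrow> 'a) \<Rightarrow> bool" where
  "maximal_in X U p q a b \<gamma> \<longleftrightarrow>
     causal_path_in X U p q a b \<gamma> \<and>
     (\<forall>a' b' \<sigma>. causal_path_in X U p q a' b' \<sigma> \<longrightarrow> tau_length_on X a' b' \<sigma> \<le> tau_length_on X a b \<gamma>)"

definition local_maximiser :: "'a lorentzian_structure \<Rightarrow> 'a set \<Rightarrow> ('a \<Rightarrow> 'a \<Rightarrow> real) \<Rightarrow>
    'a \<Rightarrow> 'a \<Rightarrow> real \<Rightarrow> real \<Rightarrow> (real \<Rightarrow> 'a) \<Rightarrow> bool" where
  "local_maximiser X U \<omega> p q a b \<gamma> \<longleftrightarrow>
     maximal_in X U p q a b \<gamma> \<and>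
     tau_length_on X a b \<gamma> = ennreal (\<omega> p q) \<and> ennreal (\<omega> p q) \<le> time_sep X p q"

definition localising_nbhd ::
    "'a lorentzian_structure \<Rightarrow> 'a set \<Rightarrow> ('a \<Rightarrow> 'a \<Rightarrow> real) \<Rightarrow> bool" where
  "localising_nbhd X U \<omega> \<longleftrightarrow>
     openin (top_of X) U \<and>
     (\<exists>C::real. \<forall>I \<gamma>. causal_curve X I \<gamma> \<and> \<gamma> ` I \<subseteq> U \<longrightarrow> d_length X I \<gamma> \<le> ennreal C) \<and>
     (\<forall>p\<in>U. \<forall>q\<in>U. 0 \<le> \<omega> p q) \<and>
     continuous_map (prod_topology (subtopology (top_of X) U) (subtopology (top_of X) U))
       euclideanreal (\<lambda>(p, q). \<omega> p q) \<and>
     lorentzian_pre_length_space (X\<lparr>points := U, time_sep := \<lambda>p q. ennreal (\<omega> p q)\<rparr>) \<and>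
     (\<forall>y\<in>U. chron_future X y \<inter> U \<noteq> {} \<and> chron_past X y \<inter> U \<noteq> {}) \<and>
     (\<forall>p\<in>U. \<forall>q\<in>U. causal X p q \<and> p \<noteq> q \<longrightarrow> (\<exists>a b \<gamma>. local_maximiser X U \<omega> p q a b \<gamma>))"

definition regular_localising_nbhd ::
    "'a lorentzian_structure \<Rightarrow> 'a set \<Rightarrow> ('a \<Rightarrow> 'a \<Rightarrow> real) \<Rightarrow> bool" where
  "regular_localising_nbhd X U \<omega> \<longleftrightarrow>
     localising_nbhd X U \<omega> \<and>
     (\<forall>p\<in>U. \<forall>q\<in>U. chron X p q \<longrightarrow>
        (\<exists>a b \<gamma>. local_maximiser X U \<omega> p q a b \<gamma> \<and> future_timelike X {a..b} \<gamma> \<and>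
           (\<forall>a' b' \<sigma>. causal_path_in X U p q a' b' \<sigma> \<and> contains_null_segment X {a'..b'} \<sigma> \<longrightarrow>
              tau_length_on X a' b' \<sigma> < tau_length_on X a b \<gamma>)))"

definition localisable :: "'a lorentzian_structure \<Rightarrow> bool" where
  "localisable X \<longleftrightarrow> (\<forall>x\<in>points X. \<exists>U \<omega>. x \<in> U \<and> localising_nbhd X U \<omega>)"

definition regularly_localisable :: "'a lorentzian_structure \<Rightarrow> bool" where
  "regularly_localisable X \<longleftrightarrow> (\<forall>x\<in>points X. \<exists>U \<omega>. x \<in> U \<and> regular_localising_nbhd X U \<omega>)"


section \<open>Lorentzian length spaces\<close>

definition causally_path_connected :: "'a lorentzian_structure \<Rightarrow> bool" where
  "causally_path_connected X \<longleftrightarrow>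
     (\<forall>x\<in>points X. \<forall>y\<in>points X.
        (chron X x y \<longrightarrow> (\<exists>a b \<gamma>. future_timelike X {a..b} \<gamma> \<and> \<gamma> a = x \<and> \<gamma> b = y)) \<and>
        (causal X x y \<and> x \<noteq> y \<longrightarrow> (\<exists>a b \<gamma>. future_causal X {a..b} \<gamma> \<and> \<gamma> a = x \<and> \<gamma> b = y)))"

definition locally_causally_closed :: "'a lorentzian_structure \<Rightarrow> bool" where
  "locally_causally_closed X \<longleftrightarrow>
     (\<forall>x\<in>points X. \<exists>V U. openin (top_of X) V \<and> x \<in> V \<and> V \<subseteq> U \<and> U \<subseteq> points X \<and>
        (let K = top_of X closure_of U in
         closedin (prod_topology (subtopology (top_of X) K) (subtopology (top_of X) K))
           {(p, q). p \<in> K \<and> q \<in> K \<and> causal X p q}))"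

text \<open>The supremum of the empty set is 0 in \<open>ennreal\<close>, so the case without connecting causal
  curves is included.\<close>

definition sup_length :: "'a lorentzian_structure \<Rightarrow> 'a \<Rightarrow> 'a \<Rightarrow> ennreal" where
  "sup_length X x y = Sup {tau_length_on X a b \<gamma> | a b \<gamma>. causal_path_in X (points X) x y a b \<gamma>}"

definition lorentzian_length_space :: "'a lorentzian_structure \<Rightarrow> bool" where
  "lorentzian_length_space X \<longleftrightarrow>
     lorentzian_pre_length_space X \<and> locally_causally_closed X \<and> causally_path_connected X \<and>
     localisable X \<and> (\<forall>x\<in>points X. \<forall>y\<in>points X. time_sep X x y = sup_length X x y)"

definition regular_lorentzian_length_space :: "'a lorentzian_structure \<Rightarrow> bool" where
  "regular_lorentzian_length_space X \<longleftrightarrow> lorentzian_length_space X \<and> regularly_localisable X"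

text \<open>The carrier is inserted because, by convention, it is open in the topology with a given
  subbase (as the empty intersection), whereas \<open>topology_generated_by\<close> only uses the union of the
  generating sets as its space.\<close>

definition strongly_causal :: "'a lorentzian_structure \<Rightarrow> bool" where
  "strongly_causal X \<longleftrightarrow>
     topology_generated_by (insert (points X)
       {chron_future X x \<inter> chron_past X y | x y. x \<in> points X \<and> y \<in> points X}) = top_of X"


section \<open>Geodesics and timelike completeness\<close>

definition geodesic :: "'a lorentzian_structure \<Rightarrow> real set \<Rightarrow> (real \<Rightarrow> 'a) \<Rightarrow> bool" where
  "geodesic X I \<gamma> \<longleftrightarrow>
     future_causal X I \<gamma> \<and>
     (\<forall>t\<in>I. \<exists>U \<omega> c d e. localising_nbhd X U \<omega> \<and> \<gamma> t \<in> U \<and>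
        c < d \<and> 0 < e \<and> I \<inter> ball t e \<subseteq> {c..d} \<and> {c..d} \<subseteq> I \<and>
        \<gamma> ` {c..d} \<subseteq> U \<and> tau_length_on X c d \<gamma> = ennreal (\<omega> (\<gamma> c) (\<gamma> d)))"

definition timelike_geodesic :: "'a lorentzian_structure \<Rightarrow> real set \<Rightarrow> (real \<Rightarrow> 'a) \<Rightarrow> bool" where
  "timelike_geodesic X I \<gamma> \<longleftrightarrow> geodesic X I \<gamma> \<and> timelike_curve X I \<gamma>"

definition future_extendible ::
    "'a lorentzian_structure \<Rightarrow> real \<Rightarrow> real \<Rightarrow> (real \<Rightarrow> 'a) \<Rightarrow> bool" where
  "future_extendible X a b \<gamma> \<longleftrightarrow> (\<exists>\<gamma>'. geodesic X {a..b} \<gamma>' \<and> (\<forall>t\<in>{a..<b}. \<gamma>' t = \<gamma> t))"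

definition past_extendible ::
    "'a lorentzian_structure \<Rightarrow> real \<Rightarrow> real \<Rightarrow> (real \<Rightarrow> 'a) \<Rightarrow> bool" where
  "past_extendible X a b \<gamma> \<longleftrightarrow> (\<exists>\<gamma>'. geodesic X {a..b} \<gamma>' \<and> (\<forall>t\<in>{a<..b}. \<gamma>' t = \<gamma> t))"

text \<open>Inextendibility does not depend on the parametrisation: a geodesic is inextendible if none
  of its reparametrisations extends. Otherwise any timelike geodesic \<open>\<gamma>\<close> on \<open>[a, b]\<close> would yield an
  inextendible one of finite length, by running through \<open>\<gamma>\<close> on \<open>[a, b)\<close> with a speed that blows up
  so fast at \<open>b\<close> that the continuous extension is not Lipschitz there (such as \<open>-sqrt (1 - t)\<close> on
  the time axis of Minkowski space), and no space containing a timelike geodesic would be complete.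
  The same convention makes it unnecessary to consider parameter intervals \<open>[a, \<infinity>)\<close>.\<close>

definition reparametrisation :: "real set \<Rightarrow> (real \<Rightarrow> real) \<Rightarrow> bool" where
  "reparametrisation I \<phi> \<longleftrightarrow> strict_mono_on I \<phi> \<and> \<phi> ` I = I"

definition future_inextendible ::
    "'a lorentzian_structure \<Rightarrow> real \<Rightarrow> real \<Rightarrow> (real \<Rightarrow> 'a) \<Rightarrow> bool" where
  "future_inextendible X a b \<gamma> \<longleftrightarrow>
     (\<forall>\<phi>. reparametrisation {a..<b} \<phi> \<longrightarrow> \<not> future_extendible X a b (\<gamma> \<circ> \<phi>))"

definition past_inextendible ::
    "'a lorentzian_structure \<Rightarrow> real \<Rightarrow> real \<Rightarrow> (real \<Rightarrow> 'a) \<Rightarrow> bool" where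
  "past_inextendible X a b \<gamma> \<longleftrightarrow>
     (\<forall>\<phi>. reparametrisation {a<..b} \<phi> \<longrightarrow> \<not> past_extendible X a b (\<gamma> \<circ> \<phi>))"

definition property_TC :: "'a lorentzian_structure \<Rightarrow> bool" where
  "property_TC X \<longleftrightarrow>
     (\<forall>a b \<gamma>. timelike_geodesic X {a..<b} \<gamma> \<and> future_inextendible X a b \<gamma> \<longrightarrow>
        tau_length X {a..<b} \<gamma> = \<infinity>) \<and>
     (\<forall>a b \<gamma>. timelike_geodesic X {a<..b} \<gamma> \<and> past_inextendible X a b \<gamma> \<longrightarrow>
        tau_length X {a<..b} \<gamma> = \<infinity>)"

text \<open>Both conventions only weaken \<open>property_TC\<close> when it is used as a hypothesis: it follows from
  the variant with fixed parametrisations and a plain infimum over the partitions of the half-open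
  interval.\<close>

lemma property_TC_if_literal:
  assumes fut: "\<And>a b \<gamma>. timelike_geodesic X {a..<b} \<gamma> \<Longrightarrow> \<not> future_extendible X a b \<gamma> \<Longrightarrow>
      (INF (N, t) \<in> (\<Union>b'\<in>{a<..<b}. partitions a b').
         \<Sum>i<N. time_sep X (\<gamma> (t i)) (\<gamma> (t (Suc i)))) = \<infinity>"
    and past: "\<And>a b \<gamma>. timelike_geodesic X {a<..b} \<gamma> \<Longrightarrow> \<not> past_extendible X a b \<gamma> \<Longrightarrow>
      (INF (N, t) \<in> (\<Union>a'\<in>{a<..<b}. partitions a' b).
         \<Sum>i<N. time_sep X (\<gamma> (t i)) (\<gamma> (t (Suc i)))) = \<infinity>"
  shows "property_TC X"
proof -
  have refl: "reparametrisation I (\<lambda>t. t)" for I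
    by (auto simp: reparametrisation_def strict_mono_on_def)
  have ne: "a < b" if "timelike_geodesic X I \<gamma>" "I = {a..<b} \<or> I = {a<..b}" for I a b \<gamma>
    using that by (fastforce simp: timelike_geodesic_def geodesic_def directed_curve_def)
  have "tau_length X {a..<b} \<gamma> = \<infinity>"
    if g: "timelike_geodesic X {a..<b} \<gamma>" and i: "future_inextendible X a b \<gamma>" for a b \<gamma>
  proof -
    have ab: "a < b" using ne[OF g] by auto
    have nc: "\<not> compact {a..<b}"
    proof
      assume "compact {a..<b}"
      then have "closure {a..<b} = {a..<b}" using compact_imp_closed closure_closed by blast
      then show False using ab by (metis atLeastAtMost_iff atLeastLessThan_iff
            closure_atLeastLessThan less_eq_real_def less_irrefl)
    qed
    obtain b' where b': "a < b'" "b' < b" using ab dense by blast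
    have "\<not> future_extendible X a b \<gamma>"
      using i refl unfolding future_inextendible_def comp_def by blast
    from fut[OF g this] have "\<infinity> \<le> tau_length_on X a b' \<gamma>"
      unfolding tau_length_on_def
      by (metis (no_types, lifting) INF_superset_mono UN_upper b' greaterThanLessThan_iff order_refl)
    also have "\<dots> \<le> tau_length X {a..<b} \<gamma>"
      unfolding tau_length_def using nc ab b' by (auto intro!: SUP_upper2[of "(a, b')"])
    finally show ?thesis by (simp add: top_unique)
  qed
  moreover have "tau_length X {a<..b} \<gamma> = \<infinity>"
    if g: "timelike_geodesic X {a<..b} \<gamma>" and i: "past_inextendible X a b \<gamma>" for a b \<gamma>
  proof -
    have ab: "a < b" using ne[OF g] by auto
    have nc: "\<not> compact {a<..b}"
    proof
      assume "compact {a<..b}"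
      then have "closure {a<..b} = {a<..b}" using compact_imp_closed closure_closed by blast
      then show False using ab by (metis atLeastAtMost_iff greaterThanAtMost_iff
            closure_greaterThanAtMost less_eq_real_def less_irrefl)
    qed
    obtain a' where a': "a < a'" "a' < b" using ab dense by blast
    have "\<not> past_extendible X a b \<gamma>"
      using i refl unfolding past_inextendible_def comp_def by blast
    from past[OF g this] have "\<infinity> \<le> tau_length_on X a' b \<gamma>"
      unfolding tau_length_on_def
      by (metis (no_types, lifting) INF_superset_mono UN_upper a' greaterThanLessThan_iff order_refl)
    also have "\<dots> \<le> tau_length X {a<..b} \<gamma>"
      unfolding tau_length_def using nc ab a' by (auto intro!: SUP_upper2[of "(a', b)"])
    finally show ?thesis by (simp add: top_unique)
  qed
  ultimately show ?thesis unfolding property_TC_def by blast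
qed


section \<open>Extensions\<close>

text \<open>The length of a past-directed causal curve is that of the curve run backwards, so equality of
  lengths is stated for future-directed curves.\<close>

definition is_extension :: "'b lorentzian_structure \<Rightarrow> 'a lorentzian_structure \<Rightarrow> bool" where
  "is_extension Y X \<longleftrightarrow>
     connected_space (top_of Y) \<and>
     (\<exists>\<iota>. \<iota> ` points X \<subset> points Y \<and> openin (top_of Y) (\<iota> ` points X) \<and>
        (\<forall>x\<in>points X. \<forall>y\<in>points X.
           distance Y (\<iota> x) (\<iota> y) = distance X x y \<and>
           (causal X x y \<longrightarrow> causal Y (\<iota> x) (\<iota> y)) \<and>
           (chron X x y \<longrightarrow> chron Y (\<iota> x) (\<iota> y))) \<and>
        (\<forall>I \<gamma>. is_interval I \<and> \<gamma> ` I \<subseteq> points X \<longrightarrow>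
           (timelike_curve X I \<gamma> \<longleftrightarrow> timelike_curve Y I (\<iota> \<circ> \<gamma>)) \<and>
           (causal_curve X I \<gamma> \<longleftrightarrow> causal_curve Y I (\<iota> \<circ> \<gamma>))) \<and>
        (\<forall>I \<gamma>. future_causal X I \<gamma> \<longrightarrow> tau_length X I \<gamma> = tau_length Y I (\<iota> \<circ> \<gamma>)))"

end

theory Submission
  imports Defs
begin

text \<open>Let \<open>\<iota>\<close> embed \<open>X\<close> as an extension into a regular Lorentzian length space \<open>Y\<close>. Since \<open>Y\<close> is
  connected, the open proper subset \<open>W = \<iota> ` points X\<close> has a frontier point \<open>p\<close>. In a regular
  localising neighbourhood \<open>U\<close> of \<open>p\<close> there is a point \<open>y\<close> with \<open>p \<lless> y\<close>, where \<open>\<lless>\<close> stands for the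
  chronological relation of \<open>Y\<close>. Either \<open>y\<close> lies in \<open>W\<close>, or, the past of \<open>y\<close> being an open
  neighbourhood of \<open>p\<close>, some \<open>x \<in> W \<inter> U\<close> satisfies \<open>x \<lless> y\<close>. In both cases two chronologically
  related points of \<open>U\<close> are separated by \<open>W\<close> (\<open>frontier_crossing_chron\<close>), and regularity joins
  them by a maximiser \<open>\<gamma>\<close> that is timelike.

  Cut \<open>\<gamma>\<close> where it first leaves \<open>W\<close>, or where it last enters \<open>W\<close>. The piece in \<open>W\<close> is a timelike
  curve \<open>\<sigma>\<close> in \<open>X\<close> on a half-open interval, and it contradicts timelike completeness of \<open>X\<close>:

  \<^item> It has finite length, because segments of \<open>\<gamma>\<close> are no longer than the finite local time
    separation of the endpoints of \<open>\<gamma>\<close>.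

  \<^item> It is a geodesic of \<open>X\<close> (\<open>pullback_maximiser\<close>). Segments of \<open>\<gamma>\<close> are maximal in \<open>U\<close>, but a
    competitor of a segment of \<open>\<sigma>\<close> inside a localising neighbourhood of \<open>X\<close> need not stay in the
    preimage of \<open>U\<close>. Strong causality of \<open>X\<close> removes this obstacle: every point has arbitrarily
    small causally convex neighbourhoods (\<open>strongly_causal_convex_nbhd\<close>), so that competitors of
    sufficiently short segments are confined to the preimage of \<open>U\<close>.

  \<^item> No reparametrisation of it extends as a geodesic: a continuous extension would end at a point
    of \<open>X\<close> whose image is the point where \<open>\<gamma>\<close> leaves \<open>W\<close> (\<open>endpoint_of_extension\<close>).\<close>


section \<open>Lengths\<close>

lemma partition_mono:
  assumes "(N, t) \<in> partitions a b" "i \<le> j" "j \<le> N"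
  shows "t i \<le> t j"
  using assms(2,3)
proof (induction j rule: dec_induct)
  case (step n)
  then have "t n < t (Suc n)" using assms(1) by (auto simp: partitions_def)
  with step show ?case by auto
qed simp

lemma partition_in_interval:
  assumes "(N, t) \<in> partitions a b" "i \<le> N"
  shows "t i \<in> {a..b}"
  using partition_mono[OF assms(1), of 0 i] partition_mono[OF assms(1), of i N] assms
  by (auto simp: partitions_def)

lemma tau_length_on_cong:
  assumes "\<And>t. t \<in> {a..b} \<Longrightarrow> \<gamma> t = \<gamma>' t"
  shows "tau_length_on X a b \<gamma> = tau_length_on X a b \<gamma>'"
  unfolding tau_length_on_def
proof (intro INF_cong refl, clarify)
  fix N t assume p: "(N, t) \<in> partitions a b"
  show "(\<Sum>i<N. time_sep X (\<gamma> (t i)) (\<gamma> (t (Suc i)))) = (\<Sum>i<N. time_sep X (\<gamma>' (t i)) (\<gamma>' (t (Suc i))))"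
    using partition_in_interval[OF p] assms by (intro sum.cong) auto
qed

text \<open>Partitions of \<open>[a, b]\<close> and \<open>[b, c]\<close> concatenate to one of \<open>[a, c]\<close>. If
  \<open>a \<le> b \<le> c\<close> fails, then one of the two sets of partitions is empty and the right-hand side is
  infinite; if two endpoints coincide, the partition without steps takes part.\<close>

lemma tau_length_on_subadditive:
  "tau_length_on X a c \<gamma> \<le> tau_length_on X a b \<gamma> + tau_length_on X b c \<gamma>"
proof -
  let ?S = "\<lambda>N t. \<Sum>i<N. time_sep X (\<gamma> (t i)) (\<gamma> (t (Suc i)))"
  have concat: "tau_length_on X a c \<gamma> \<le> ?S N t + ?S M u"
    if p: "(N, t) \<in> partitions a b" and q: "(M, u) \<in> partitions b c" for N t M u
  proof -
    define v where "v i = (if i \<le> N then t i else u (i - N))" for i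
    \<comment> \<open>At \<open>i = 0\<close> the two partitions agree, as both \<open>t N\<close> and \<open>u 0\<close> are \<open>b\<close>.\<close>
    have v2: "v (N + i) = u i" for i
      using p q by (auto simp: v_def partitions_def)
    have "v i < v (Suc i)" if "i < N + M" for i
    proof (cases "i < N")
      case True
      then show ?thesis using p by (auto simp: v_def partitions_def)
    next
      case False
      then obtain j where j: "i = N + j" using le_Suc_ex not_less by blast
      have "v (Suc i) = u (Suc j)" "v i = u j" using v2[of j] v2[of "Suc j"] j by auto
      then show ?thesis using that q j by (auto simp: partitions_def)
    qed
    then have "(N + M, v) \<in> partitions a c"
      using p q v2[of M] by (auto simp: partitions_def v_def)
    then have "tau_length_on X a c \<gamma> \<le> ?S (N + M) v"
      unfolding tau_length_on_def by (intro INF_lower2[where i="(N + M, v)"]) auto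
    also have "?S (N + M) v = ?S N v + (\<Sum>i<M. time_sep X (\<gamma> (v (N + i))) (\<gamma> (v (N + Suc i))))"
      by (induction M) (auto simp: add.assoc)
    also have "?S N v = ?S N t" by (intro sum.cong) (auto simp: v_def)
    finally show ?thesis by (simp only: v2)
  qed
  have le: "tau_length_on X a c \<gamma> \<le> ?S N t + tau_length_on X b c \<gamma>"
    if p: "(N, t) \<in> partitions a b" for N t
  proof (cases "?S N t = top")
    case False
    have "tau_length_on X a c \<gamma> - ?S N t \<le> ?S M u" if q: "(M, u) \<in> partitions b c" for M u
      using concat[OF p q] False unfolding ennreal_minus_le_iff by blast
    then have "tau_length_on X a c \<gamma> - ?S N t \<le> tau_length_on X b c \<gamma>"
      unfolding tau_length_on_def[of X b c] by (intro INF_greatest) auto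
    then show ?thesis unfolding ennreal_minus_le_iff by (rule conjunct1)
  next
    case True
    show ?thesis unfolding True by simp
  qed
  show ?thesis
  proof (cases "tau_length_on X b c \<gamma> = top")
    case False
    have "tau_length_on X a c \<gamma> - tau_length_on X b c \<gamma> \<le> ?S N t"
      if p: "(N, t) \<in> partitions a b" for N t
      using le[OF p] False unfolding ennreal_minus_le_iff by (simp only: add.commute) simp
    then have "tau_length_on X a c \<gamma> - tau_length_on X b c \<gamma> \<le> tau_length_on X a b \<gamma>"
      unfolding tau_length_on_def[of X a b] by (intro INF_greatest) auto
    then have "tau_length_on X a c \<gamma> \<le> tau_length_on X b c \<gamma> + tau_length_on X a b \<gamma>"
      unfolding ennreal_minus_le_iff by (rule conjunct1)
    then show ?thesis by (simp only: add.commute)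
  qed simp
qed

lemma tau_length_on_trivial: "tau_length_on X a a \<gamma> = 0"
proof -
  have "(0, \<lambda>_. a) \<in> partitions a a" by (auto simp: partitions_def)
  then have "tau_length_on X a a \<gamma> \<le> 0"
    unfolding tau_length_on_def by (intro INF_lower2[where i="(0, \<lambda>_. a)"]) auto
  then show ?thesis by simp
qed

lemma tau_length_compact:
  assumes "a \<le> b"
  shows "tau_length X {a..b} \<gamma> = tau_length_on X a b \<gamma>"
  using assms by (simp add: tau_length_def)


section \<open>Curves\<close>

lemma directed_curve_cong:
  assumes "\<And>t. t \<in> I \<Longrightarrow> \<gamma> t = \<gamma>' t" "directed_curve X R I \<gamma>"
  shows "directed_curve X R I \<gamma>'"
  using assms(2) unfolding directed_curve_def locally_lipschitz_curve_def image_subset_iff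
  by (simp add: assms(1))

text \<open>The points \<open>s\<close> and \<open>t\<close> keep the restricted curve non-constant, as the notion of a directed
  curve demands.\<close>

lemma directed_curve_subinterval:
  assumes "directed_curve X R I \<gamma>" "J \<subseteq> I" "is_interval J" "s \<in> J" "t \<in> J" "\<gamma> s \<noteq> \<gamma> t"
  shows "directed_curve X R J \<gamma>"
proof -
  have "locally_lipschitz_curve X J \<gamma>"
    unfolding locally_lipschitz_curve_def
  proof
    fix t assume "t \<in> J"
    then obtain e L where "e > 0" "\<forall>r\<in>I \<inter> ball t e. \<forall>s\<in>I \<inter> ball t e. distance X (\<gamma> r) (\<gamma> s) \<le> L * \<bar>r - s\<bar>"
      using assms(1,2) unfolding directed_curve_def locally_lipschitz_curve_def by (meson subsetD)
    then show "\<exists>e>0. \<exists>L. \<forall>r\<in>J \<inter> ball t e. \<forall>s\<in>J \<inter> ball t e. distance X (\<gamma> r) (\<gamma> s) \<le> L * \<bar>r - s\<bar>"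
      using assms(2) by (intro exI[of _ e] conjI exI[of _ L]) auto
  qed
  then show ?thesis using assms unfolding directed_curve_def by blast
qed

lemma directed_curve_continuous:
  assumes "directed_curve X R I \<gamma>" "t \<in> I" "\<epsilon> > 0"
  obtains e where "e > 0" "\<And>r. r \<in> I \<Longrightarrow> \<bar>r - t\<bar> < e \<Longrightarrow> distance X (\<gamma> t) (\<gamma> r) < \<epsilon>"
proof -
  obtain e L where e: "e > 0" and L: "\<forall>r\<in>I \<inter> ball t e. \<forall>s\<in>I \<inter> ball t e. distance X (\<gamma> r) (\<gamma> s) \<le> L * \<bar>r - s\<bar>"
    using assms(1,2) unfolding directed_curve_def locally_lipschitz_curve_def by meson
  define e' where "e' = min e (\<epsilon> / (\<bar>L\<bar> + 1))"
  have "distance X (\<gamma> t) (\<gamma> r) < \<epsilon>" if "r \<in> I" "\<bar>r - t\<bar> < e'" for r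
  proof -
    have "distance X (\<gamma> t) (\<gamma> r) \<le> L * \<bar>t - r\<bar>"
      using L[rule_format, of t r] that assms(2) e by (auto simp: e'_def dist_real_def abs_minus_commute)
    also have "\<dots> \<le> (\<bar>L\<bar> + 1) * \<bar>t - r\<bar>" by (intro mult_right_mono) auto
    also have "\<dots> < \<epsilon>"
      using that by (auto simp: e'_def abs_minus_commute pos_less_divide_eq mult.commute)
    finally show ?thesis .
  qed
  then show thesis using that[of e'] e assms(3) by (auto simp: e'_def add_nonneg_pos)
qed

lemma directed_curve_near:
  assumes "Metric_space (points X) (distance X)" "directed_curve X R I \<gamma>" "t \<in> I"
    and "openin (top_of X) V" "\<gamma> t \<in> V"
  obtains e where "e > 0" "\<And>r. r \<in> I \<Longrightarrow> \<bar>r - t\<bar> < e \<Longrightarrow> \<gamma> r \<in> V"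
proof -
  interpret Metric_space "points X" "distance X" by fact
  obtain \<epsilon> where \<epsilon>: "\<epsilon> > 0" "mball (\<gamma> t) \<epsilon> \<subseteq> V" using assms(4,5) by (auto simp: openin_mtopology)
  obtain e where "e > 0" and e: "\<And>r. r \<in> I \<Longrightarrow> \<bar>r - t\<bar> < e \<Longrightarrow> distance X (\<gamma> t) (\<gamma> r) < \<epsilon>"
    using directed_curve_continuous[OF assms(2,3) \<epsilon>(1)] by metis
  have "\<gamma> r \<in> points X" if "r \<in> I" for r using that assms(2) by (auto simp: directed_curve_def)
  then show thesis using that[OF \<open>e > 0\<close>] e \<epsilon>(2) assms(3) by (auto simp: in_mball subset_iff)
qed

lemma timelike_imp_causal:
  assumes "lorentzian_pre_length_space X" "future_timelike X I \<gamma>"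
  shows "future_causal X I \<gamma>"
  using assms unfolding lorentzian_pre_length_space_def causal_space_def directed_curve_def
  by (auto simp: image_subset_iff)


lemma causal_path_less:
  assumes "causal_path_in X U p q a b \<gamma>" "p \<noteq> q"
  shows "a < b"
proof -
  have "{a..b} \<noteq> {}" using assms(1) unfolding causal_path_in_def directed_curve_def by blast
  moreover have "a \<noteq> b" using assms by (auto simp: causal_path_in_def)
  ultimately show ?thesis by auto
qed


section \<open>Causality\<close>

text \<open>The push-up property: the reverse triangle inequality propagates positivity of the time
  separation along a causal relation on either side.\<close>

lemma chron_causal_trans:
  assumes "lorentzian_pre_length_space X" "x \<in> points X" "y \<in> points X" "z \<in> points X"
    and "chron X x y" "causal X y z"
  shows "chron X x z"
proof -
  have "causal X x y" "0 < time_sep X x y"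
    using assms unfolding lorentzian_pre_length_space_def causal_space_def by blast+
  then have "time_sep X x y + time_sep X y z \<le> time_sep X x z"
    using assms unfolding lorentzian_pre_length_space_def by blast
  then have "0 < time_sep X x z"
    using \<open>0 < time_sep X x y\<close> by (metis add.right_neutral add_left_mono order_less_le_trans zero_le)
  then show ?thesis using assms unfolding lorentzian_pre_length_space_def by blast
qed

lemma causal_chron_trans:
  assumes "lorentzian_pre_length_space X" "x \<in> points X" "y \<in> points X" "z \<in> points X"
    and "causal X x y" "chron X y z"
  shows "chron X x z"
proof -
  have "causal X y z" "0 < time_sep X y z"
    using assms unfolding lorentzian_pre_length_space_def causal_space_def by blast+
  then have "time_sep X x y + time_sep X y z \<le> time_sep X x z"
    using assms unfolding lorentzian_pre_length_space_def by blast
  then have "0 < time_sep X x z"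
    using \<open>0 < time_sep X y z\<close> by (metis add.left_neutral add_right_mono order_less_le_trans zero_le)
  then show ?thesis using assms unfolding lorentzian_pre_length_space_def by blast
qed

text \<open>The past of \<open>y\<close> is a slice of the set where the time separation is positive, and that set is
  open by lower semicontinuity.\<close>

lemma openin_chron_past:
  assumes "lorentzian_pre_length_space X" "y \<in> points X"
  shows "openin (top_of X) (chron_past X y)"
proof -
  interpret Metric_space "points X" "distance X"
    using assms by (auto simp: lorentzian_pre_length_space_def)
  let ?P = "{z \<in> topspace (prod_topology mtopology mtopology). 0 < (\<lambda>(x, y). time_sep X x y) z}"
  have "openin (prod_topology mtopology mtopology) ?P"
    using assms unfolding lorentzian_pre_length_space_def lower_semicontinuous_map_def by blast
  moreover have "continuous_map mtopology (prod_topology mtopology mtopology) (\<lambda>x. (x, y))"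
    using assms(2) by (intro continuous_map_pairedI) auto
  ultimately have "openin mtopology {x \<in> topspace mtopology. (x, y) \<in> ?P}"
    by (rule openin_continuous_map_preimage[rotated])
  moreover have "{x \<in> topspace mtopology. (x, y) \<in> ?P} = chron_past X y"
    using assms unfolding lorentzian_pre_length_space_def chron_past_def by auto
  ultimately show ?thesis by simp
qed

text \<open>Chronological diamonds are causally convex by the push-up property, and causal convexity
  survives finite intersections. Hence a topology with the diamonds as a subbase has a base of
  causally convex sets. This is the only way in which strong causality enters.\<close>

lemma strongly_causal_convex_nbhd:
  assumes "lorentzian_pre_length_space X" "strongly_causal X" "openin (top_of X) V" "x \<in> V"
  obtains N where "openin (top_of X) N" "x \<in> N" "N \<subseteq> V"
    "\<And>p q r. p \<in> N \<Longrightarrow> q \<in> N \<Longrightarrow> r \<in> points X \<Longrightarrow> causal X p r \<Longrightarrow> causal X r q \<Longrightarrow> r \<in> N"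
proof -
  define causally_convex where
    "causally_convex N \<longleftrightarrow> (\<forall>p\<in>N. \<forall>q\<in>N. \<forall>r\<in>points X. causal X p r \<and> causal X r q \<longrightarrow> r \<in> N)" for N
  define B where "B = insert (points X)
       {chron_future X x \<inter> chron_past X y | x y. x \<in> points X \<and> y \<in> points X}"
  have top: "top_of X = topology_generated_by B"
    using assms(2) by (simp add: strongly_causal_def B_def)
  have "generate_topology_on B V"
    using assms(3) by (simp add: top openin_topology_generated_by_iff)
  then have "\<forall>x\<in>V. \<exists>N. openin (top_of X) N \<and> x \<in> N \<and> N \<subseteq> V \<and> causally_convex N"
  proof induction
    case (Int V W)
    show ?case
    proof
      fix x assume "x \<in> V \<inter> W"
      then have x: "x \<in> V" "x \<in> W" by auto
      obtain N where N: "openin (top_of X) N" "x \<in> N" "N \<subseteq> V" "causally_convex N"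
        using bspec[OF Int.IH(1) x(1)] by blast
      obtain M where M: "openin (top_of X) M" "x \<in> M" "M \<subseteq> W" "causally_convex M"
        using bspec[OF Int.IH(2) x(2)] by blast
      have "openin (top_of X) (N \<inter> M)" using N(1) M(1) by (rule openin_Int)
      moreover have "causally_convex (N \<inter> M)"
        using N(4) M(4) unfolding causally_convex_def by blast
      ultimately show "\<exists>N. openin (top_of X) N \<and> x \<in> N \<and> N \<subseteq> V \<inter> W \<and> causally_convex N"
        using N(2,3) M(2,3) by blast
    qed
  next
    case (UN K)
    show ?case
    proof
      fix x assume "x \<in> \<Union> K"
      then obtain V where "V \<in> K" "x \<in> V" by blast
      obtain N where "openin (top_of X) N" "x \<in> N" "N \<subseteq> V" "causally_convex N"
        using bspec[OF UN.IH[OF \<open>V \<in> K\<close>] \<open>x \<in> V\<close>] by blast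
      with \<open>V \<in> K\<close> show "\<exists>N. openin (top_of X) N \<and> x \<in> N \<and> N \<subseteq> \<Union> K \<and> causally_convex N" by blast
    qed
  next
    case (Basis s)
    then have o: "openin (top_of X) s" by (simp add: top topology_generated_by_Basis)
    have "r \<in> s" if pq: "p \<in> s" "q \<in> s" "r \<in> points X" "causal X p r" "causal X r q" for p q r
    proof (cases "s = points X")
      case False
      then obtain x y where "x \<in> points X" "y \<in> points X" and s: "s = chron_future X x \<inter> chron_past X y"
        using Basis by (auto simp: B_def)
      then have "chron X x r" "chron X r y"
        using pq chron_causal_trans[OF assms(1), of x p r] causal_chron_trans[OF assms(1), of r q y]
        unfolding s chron_future_def chron_past_def by blast+
      then show ?thesis using pq(3) unfolding s chron_future_def chron_past_def by blast
    qed (use pq in auto)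
    then have "causally_convex s" unfolding causally_convex_def by blast
    with o show ?case by blast
  qed simp
  then obtain N where "openin (top_of X) N" "x \<in> N" "N \<subseteq> V" "causally_convex N"
    using assms(4) by blast
  then show thesis using that unfolding causally_convex_def by blast
qed


section \<open>Maximisers in localising neighbourhoods\<close>

context
  fixes X :: "'a lorentzian_structure" and U \<omega>
  assumes pre: "lorentzian_pre_length_space X" and loc: "localising_nbhd X U \<omega>"
begin

lemma localising_pre: "lorentzian_pre_length_space (X\<lparr>points := U, time_sep := \<lambda>p q. ennreal (\<omega> p q)\<rparr>)"
  using loc by (simp add: localising_nbhd_def)

lemma localising_nonneg: "p \<in> U \<Longrightarrow> q \<in> U \<Longrightarrow> 0 \<le> \<omega> p q"
  using loc by (simp add: localising_nbhd_def)

lemma localising_subset: "U \<subseteq> points X"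
proof -
  interpret Metric_space "points X" "distance X"
    using pre by (auto simp: lorentzian_pre_length_space_def)
  show ?thesis using loc openin_subset[of mtopology U] by (auto simp: localising_nbhd_def)
qed

lemma localising_triangle:
  assumes "p \<in> U" "q \<in> U" "r \<in> U" "causal X p q" "causal X q r"
  shows "\<omega> p q + \<omega> q r \<le> \<omega> p r"
proof -
  have "ennreal (\<omega> p q) + ennreal (\<omega> q r) \<le> ennreal (\<omega> p r)"
    using localising_pre assms unfolding lorentzian_pre_length_space_def by simp
  then show ?thesis using assms localising_nonneg by (simp flip: ennreal_plus)
qed

text \<open>A point in its own future would have \<open>\<omega> p p > 0\<close> and \<open>\<omega> p p + \<omega> p p \<le> \<omega> p p\<close>, which is
  impossible because \<open>\<omega>\<close> is finite.\<close>

lemma localising_chron_irrefl: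
  assumes "p \<in> U" shows "\<not> chron X p p"
proof
  assume c: "chron X p p"
  then have "0 < \<omega> p p" "causal X p p"
    using localising_pre assms pre localising_subset
    unfolding lorentzian_pre_length_space_def causal_space_def by auto
  then show False using localising_triangle[of p p p] assms by auto
qed

lemma tau_length_le_localising:
  assumes "causal_path_in X U p q a b \<gamma>" "p \<noteq> q"
  shows "tau_length_on X a b \<gamma> \<le> ennreal (\<omega> p q)"
proof -
  have "a < b" using assms by (rule causal_path_less)
  then have "p \<in> U" "q \<in> U" "causal X p q"
    using assms by (auto simp: causal_path_in_def directed_curve_def)
  then obtain a' b' \<sigma> where "local_maximiser X U \<omega> p q a' b' \<sigma>"
    using loc assms(2) unfolding localising_nbhd_def by blast
  then have "\<forall>a b \<gamma>. causal_path_in X U p q a b \<gamma> \<longrightarrow> tau_length_on X a b \<gamma> \<le> tau_length_on X a' b' \<sigma>"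
    and "tau_length_on X a' b' \<sigma> = ennreal (\<omega> p q)"
    unfolding local_maximiser_def maximal_in_def by blast+
  then show ?thesis using assms(1) by metis
qed

context
  fixes a b \<gamma>
  assumes tl: "future_timelike X {a..b} \<gamma>" and img: "\<gamma> ` {a..b} \<subseteq> U"
begin

lemma localised_timelike_injective:
  assumes "s \<in> {a..b}" "t \<in> {a..b}" "s < t"
  shows "\<gamma> s \<noteq> \<gamma> t"
proof
  assume "\<gamma> s = \<gamma> t"
  then have "chron X (\<gamma> s) (\<gamma> s)" using assms tl unfolding directed_curve_def by metis
  then show False using localising_chron_irrefl img assms by blast
qed

lemma localised_timelike_causal:
  assumes "s \<in> {a..b}" "t \<in> {a..b}" "s \<le> t"
  shows "causal X (\<gamma> s) (\<gamma> t)"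
proof (cases "s = t")
  case True
  then show ?thesis
    using assms pre img localising_subset
    by (force simp: lorentzian_pre_length_space_def causal_space_def reflp_on_def)
next
  case False
  then show ?thesis
    using timelike_imp_causal[OF pre tl] assms unfolding directed_curve_def by force
qed

lemma localised_timelike_segment:
  assumes "a \<le> c" "c < d" "d \<le> b"
  shows "future_timelike X {c..d} \<gamma>"
  using directed_curve_subinterval[OF tl, of "{c..d}" c d] localised_timelike_injective[of c d] assms
  by (auto simp: is_interval_cc)

lemma localised_timelike_segment_length_le:
  assumes "a \<le> c" "c \<le> d" "d \<le> b"
  shows "tau_length_on X c d \<gamma> \<le> ennreal (\<omega> (\<gamma> c) (\<gamma> d))"
proof (cases "c = d")
  case False
  then have "causal_path_in X U (\<gamma> c) (\<gamma> d) c d \<gamma>"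
    using timelike_imp_causal[OF pre localised_timelike_segment[of c d]] assms img
    by (auto simp: causal_path_in_def)
  then show ?thesis using False assms localised_timelike_injective[of c d] tau_length_le_localising by auto
qed (simp add: tau_length_on_trivial)

text \<open>If a segment were shorter than the local time separation of its endpoints, then by the
  reverse triangle inequality for \<open>\<omega>\<close> the whole curve would be shorter than \<open>\<omega> (\<gamma> a) (\<gamma> b)\<close>.\<close>

lemma maximiser_segment:
  assumes max: "tau_length_on X a b \<gamma> = ennreal (\<omega> (\<gamma> a) (\<gamma> b))"
    and cd: "a \<le> c" "c \<le> d" "d \<le> b"
  shows "tau_length_on X c d \<gamma> = ennreal (\<omega> (\<gamma> c) (\<gamma> d))"
proof -
  have mem: "\<gamma> a \<in> U" "\<gamma> b \<in> U" "\<gamma> c \<in> U" "\<gamma> d \<in> U" using img cd by auto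
  note nn = localising_nonneg[OF mem(1,3)] localising_nonneg[OF mem(3,4)]
    localising_nonneg[OF mem(4,2)] localising_nonneg[OF mem(3,2)]
  have le: "tau_length_on X c d \<gamma> \<le> ennreal (\<omega> (\<gamma> c) (\<gamma> d))"
    using localised_timelike_segment_length_le cd by simp
  then obtain l where l: "tau_length_on X c d \<gamma> = ennreal l" "0 \<le> l"
    by (metis ennreal_cases ennreal_neq_top top_unique)
  have "ennreal (\<omega> (\<gamma> a) (\<gamma> b)) \<le> tau_length_on X a c \<gamma> + (tau_length_on X c d \<gamma> + tau_length_on X d b \<gamma>)"
    unfolding max[symmetric]
    by (meson add_left_mono order_trans tau_length_on_subadditive)
  also have "\<dots> \<le> ennreal (\<omega> (\<gamma> a) (\<gamma> c)) + (ennreal l + ennreal (\<omega> (\<gamma> d) (\<gamma> b)))"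
    unfolding l(1)[symmetric]
    using localised_timelike_segment_length_le[of a c] localised_timelike_segment_length_le[of d b] cd
    by (intro add_mono) auto
  also have "\<dots> = ennreal (\<omega> (\<gamma> a) (\<gamma> c) + (l + \<omega> (\<gamma> d) (\<gamma> b)))"
    using nn l(2) by simp
  finally have "\<omega> (\<gamma> a) (\<gamma> b) \<le> \<omega> (\<gamma> a) (\<gamma> c) + (l + \<omega> (\<gamma> d) (\<gamma> b))"
    using nn l(2) by (subst (asm) ennreal_le_iff) auto
  moreover have "\<omega> (\<gamma> a) (\<gamma> c) + \<omega> (\<gamma> c) (\<gamma> b) \<le> \<omega> (\<gamma> a) (\<gamma> b)"
    "\<omega> (\<gamma> c) (\<gamma> d) + \<omega> (\<gamma> d) (\<gamma> b) \<le> \<omega> (\<gamma> c) (\<gamma> b)"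
    using localising_triangle mem localised_timelike_causal cd by auto
  ultimately have "\<omega> (\<gamma> c) (\<gamma> d) \<le> l" by simp
  then show ?thesis using le l by (auto intro!: antisym ennreal_leI)
qed

end

end


section \<open>Pulling back maximisers along an extension\<close>

text \<open>Small compact neighbourhoods of a point within a half-open interval. At the closed end the
  point is itself an endpoint of its neighbourhood; towards the open end the neighbourhood covers
  at most half of the remaining distance.\<close>

lemma half_open_interval_cases:
  assumes "I = {a..<s} \<or> I = {s<..b}" "t \<in> I" "e > (0::real)"
  obtains c d e' where "c < d" "0 < e'" "t \<in> {c..d}" "I \<inter> ball t e' \<subseteq> {c..d}" "{c..d} \<subseteq> I"
    "\<And>r. r \<in> {c..d} \<Longrightarrow> \<bar>r - t\<bar> < e"
  using assms(1)
proof
  assume I: "I = {a..<s}"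
  define m where "m = min (e/2) ((s - t)/2)"
  have "m > 0" "m < e" "t + m < s" using assms I by (auto simp: m_def min_def field_simps)
  then show thesis using assms I
    by (intro that[of "max a (t - m)" "t + m" m]) (auto simp: dist_real_def)
next
  assume I: "I = {s<..b}"
  define m where "m = min (e/2) ((t - s)/2)"
  have "m > 0" "m < e" "s < t - m" using assms I by (auto simp: m_def min_def field_simps)
  then show thesis using assms I
    by (intro that[of "t - m" "min b (t + m)" m]) (auto simp: dist_real_def)
qed

text \<open>The clauses in the definition of an extension that transport a single curve, its causal
  character and its length between \<open>X\<close> and \<open>Y\<close>.\<close>

locale extension =
  fixes X :: "'a lorentzian_structure" and Y :: "'b lorentzian_structure" and \<iota>
  assumes pre_X: "lorentzian_pre_length_space X" and pre_Y: "lorentzian_pre_length_space Y"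
    and range: "\<iota> ` points X \<subseteq> points Y"
    and isometry: "\<And>x y. x \<in> points X \<Longrightarrow> y \<in> points X \<Longrightarrow> distance Y (\<iota> x) (\<iota> y) = distance X x y"
    and causal_mono: "\<And>x y. x \<in> points X \<Longrightarrow> y \<in> points X \<Longrightarrow> causal X x y \<Longrightarrow> causal Y (\<iota> x) (\<iota> y)"
    and chron_mono: "\<And>x y. x \<in> points X \<Longrightarrow> y \<in> points X \<Longrightarrow> chron X x y \<Longrightarrow> chron Y (\<iota> x) (\<iota> y)"
    and timelike_reflect: "\<And>I \<gamma>. is_interval I \<Longrightarrow> \<gamma> ` I \<subseteq> points X \<Longrightarrow>
      timelike_curve Y I (\<iota> \<circ> \<gamma>) \<Longrightarrow> timelike_curve X I \<gamma>"
    and length_eq: "\<And>I \<gamma>. future_causal X I \<gamma> \<Longrightarrow> tau_length X I \<gamma> = tau_length Y I (\<iota> \<circ> \<gamma>)"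
begin

sublocale MX: Metric_space "points X" "distance X"
  using pre_X by (simp add: lorentzian_pre_length_space_def)

sublocale MY: Metric_space "points Y" "distance Y"
  using pre_Y by (simp add: lorentzian_pre_length_space_def)

lemma inj: "inj_on \<iota> (points X)"
proof (rule inj_onI)
  fix x y assume xy: "x \<in> points X" "y \<in> points X" "\<iota> x = \<iota> y"
  then have "distance X x y = 0" using isometry[of x y] isometry[of y y] by simp
  then show "x = y" using xy by simp
qed

lemma open_preimage:
  assumes "openin (top_of Y) V"
  shows "openin (top_of X) {x \<in> points X. \<iota> x \<in> V}"
  unfolding MX.openin_mtopology
proof (intro conjI allI impI)
  fix x assume x: "x \<in> {x \<in> points X. \<iota> x \<in> V}"
  then obtain r where r: "r > 0" "MY.mball (\<iota> x) r \<subseteq> V" using assms by (auto simp: MY.openin_mtopology)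
  then show "\<exists>r>0. MX.mball x r \<subseteq> {x \<in> points X. \<iota> x \<in> V}"
    using x range isometry by (intro exI[of _ r]) (auto simp: subset_iff)
qed auto

lemma future_causal_image:
  assumes "future_causal X I \<gamma>"
  shows "future_causal Y I (\<iota> \<circ> \<gamma>)"
proof -
  have p: "\<gamma> t \<in> points X" if "t \<in> I" for t using assms that by (auto simp: directed_curve_def)
  have "locally_lipschitz_curve Y I (\<iota> \<circ> \<gamma>)"
    unfolding locally_lipschitz_curve_def
  proof
    fix t assume "t \<in> I"
    then obtain e L where "e > 0" "\<forall>r\<in>I \<inter> ball t e. \<forall>s\<in>I \<inter> ball t e. distance X (\<gamma> r) (\<gamma> s) \<le> L * \<bar>r - s\<bar>"
      using assms unfolding directed_curve_def locally_lipschitz_curve_def by meson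
    then show "\<exists>e>0. \<exists>L. \<forall>r\<in>I \<inter> ball t e. \<forall>s\<in>I \<inter> ball t e. distance Y ((\<iota> \<circ> \<gamma>) r) ((\<iota> \<circ> \<gamma>) s) \<le> L * \<bar>r - s\<bar>"
      by (intro exI[of _ e] conjI exI[of _ L]) (auto simp: isometry p)
  qed
  moreover have "\<exists>s\<in>I. \<exists>t\<in>I. (\<iota> \<circ> \<gamma>) s \<noteq> (\<iota> \<circ> \<gamma>) t"
    using assms p inj unfolding directed_curve_def comp_def inj_on_def by metis
  ultimately show ?thesis
    using assms p range causal_mono unfolding directed_curve_def by (auto simp: image_subset_iff)
qed

text \<open>Near each parameter, a segment of \<open>\<sigma>\<close> is compared with the maximiser \<open>\<alpha>\<close> that a localising
  neighbourhood \<open>V\<close> of \<open>X\<close> provides between its endpoints. In \<open>X\<close>, \<open>\<alpha>\<close> is at least as long. If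
  the image of \<open>\<alpha>\<close> stays in \<open>U\<close>, it is at most as long as the corresponding segment of \<open>\<gamma>\<close>, whose
  length is the length of the segment of \<open>\<sigma>\<close>; so all these lengths agree. To keep \<open>\<alpha>\<close> there, the
  segment is chosen inside a causally convex subset of \<open>V\<close> and of the preimage of \<open>U\<close>.\<close>

lemma pullback_maximiser:
  assumes sc: "strongly_causal X" and lX: "localisable X"
    and loc: "localising_nbhd Y U \<omega>"
    and tl: "future_timelike Y {a..b} \<gamma>" and img: "\<gamma> ` {a..b} \<subseteq> U"
    and max: "tau_length_on Y a b \<gamma> = ennreal (\<omega> (\<gamma> a) (\<gamma> b))"
    and I: "I = {a..<s} \<or> I = {s<..b}" "I \<subseteq> {a..b}" "I \<noteq> {}"
    and \<sigma>: "\<And>t. t \<in> I \<Longrightarrow> \<sigma> t \<in> points X \<and> \<iota> (\<sigma> t) = \<gamma> t"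
  shows "timelike_geodesic X I \<sigma>" and "tau_length X I \<sigma> \<noteq> \<infinity>"
proof -
  note seg = localised_timelike_segment[OF pre_Y loc tl img] localised_timelike_injective[OF pre_Y loc tl img]
    maximiser_segment[OF pre_Y loc tl img max]
  have ivl: "is_interval I" using I(1) by (auto simp: is_interval_co is_interval_oc)
  obtain t0 where t0: "t0 \<in> I" using I(3) by auto
  obtain u v where uv: "u \<in> I" "v \<in> I" "u < v"
  proof (rule half_open_interval_cases[OF I(1) t0 zero_less_one])
    fix c d e' assume cd: "c < d" "{c..d} \<subseteq> I"
    then have "c \<in> I" "d \<in> I" by auto
    then show thesis using cd(1) by (rule that)
  qed
  have "\<gamma> u \<noteq> \<gamma> v" using seg(2) uv I(2) by blast
  have tlI: "future_timelike Y I \<gamma>"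
    by (rule directed_curve_subinterval[OF tl I(2) ivl uv(1,2)]) fact
  have tlI': "future_timelike Y I (\<iota> \<circ> \<sigma>)"
    by (rule directed_curve_cong[OF _ tlI]) (simp add: \<sigma>)
  then have "timelike_curve X I \<sigma>"
    using timelike_reflect[OF ivl, of \<sigma>] \<sigma> by (auto simp: timelike_curve_def)
  \<comment> \<open>An extension reflects timelike curves without regard to their time direction, whereas geodesics
    are future-directed.\<close>
  moreover have "\<not> past_timelike X I \<sigma>"
  proof
    assume "past_timelike X I \<sigma>"
    then have "chron X (\<sigma> v) (\<sigma> u)" using uv by (auto simp: directed_curve_def)
    then have "chron Y (\<gamma> v) (\<gamma> u)" using chron_mono[of "\<sigma> v" "\<sigma> u"] \<sigma> uv by auto
    moreover have "chron Y (\<gamma> u) (\<gamma> v)" using tlI uv by (auto simp: directed_curve_def)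
    moreover have U: "\<gamma> u \<in> U" "\<gamma> v \<in> U" using uv I(2) img by auto
    moreover have "\<gamma> u \<in> points Y" "\<gamma> v \<in> points Y"
      using U localising_subset[OF pre_Y loc] by auto
    ultimately have "chron Y (\<gamma> u) (\<gamma> u)"
      using pre_Y unfolding lorentzian_pre_length_space_def causal_space_def transp_on_def by blast
    then show False using localising_chron_irrefl[OF pre_Y loc] U by blast
  qed
  ultimately have tlX: "future_timelike X I \<sigma>" by (auto simp: timelike_curve_def)
  have len: "future_causal X {c..d} \<sigma>" "tau_length_on X c d \<sigma> = ennreal (\<omega> (\<gamma> c) (\<gamma> d))"
    if cd: "c < d" "{c..d} \<subseteq> I" for c d
  proof -
    have c: "c \<in> I" "d \<in> I" using cd by auto
    have "\<gamma> c \<noteq> \<gamma> d" using seg(2) c cd I(2) by blast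
    then have "\<sigma> c \<noteq> \<sigma> d" using \<sigma> c by metis
    then show fc: "future_causal X {c..d} \<sigma>"
      by (intro directed_curve_subinterval[OF timelike_imp_causal[OF pre_X tlX], of _ c d])
        (use cd in \<open>auto simp: is_interval_cc\<close>)
    have "tau_length_on X c d \<sigma> = tau_length_on Y c d (\<iota> \<circ> \<sigma>)"
      using length_eq[OF fc] cd by (simp add: tau_length_compact)
    also have "\<dots> = tau_length_on Y c d \<gamma>"
      by (rule tau_length_on_cong) (use cd \<sigma> in auto)
    also have "\<dots> = ennreal (\<omega> (\<gamma> c) (\<gamma> d))" using seg(3)[of c d] cd(1) c I(2) by fastforce
    finally show "tau_length_on X c d \<sigma> = ennreal (\<omega> (\<gamma> c) (\<gamma> d))" .
  qed
  have "geodesic X I \<sigma>"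
    unfolding geodesic_def
  proof (intro conjI ballI)
    fix t assume t: "t \<in> I"
    then have "\<sigma> t \<in> points X" using \<sigma> by simp
    then obtain V \<eta> where V: "\<sigma> t \<in> V" "localising_nbhd X V \<eta>" using lX by (auto simp: localisable_def)
    define P where "P = {x \<in> points X. \<iota> x \<in> U}"
    have "openin (top_of X) (V \<inter> P)"
      using V(2) loc by (auto simp: localising_nbhd_def P_def intro!: openin_Int open_preimage)
    moreover have "\<sigma> t \<in> V \<inter> P" using V(1) t \<sigma> I(2) img by (auto simp: P_def)
    ultimately obtain N where N: "openin (top_of X) N" "\<sigma> t \<in> N" "N \<subseteq> V \<inter> P"
      and convex: "\<And>p q r. p \<in> N \<Longrightarrow> q \<in> N \<Longrightarrow> r \<in> points X \<Longrightarrow> causal X p r \<Longrightarrow> causal X r q \<Longrightarrow> r \<in> N"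
      using strongly_causal_convex_nbhd[OF pre_X sc] by blast
    obtain e where e: "e > 0" "\<And>r. r \<in> I \<Longrightarrow> \<bar>r - t\<bar> < e \<Longrightarrow> \<sigma> r \<in> N"
      using directed_curve_near[OF MX.Metric_space_axioms tlX t N(1,2)] by metis
    obtain c d e' where cd: "c < d" "0 < e'" "I \<inter> ball t e' \<subseteq> {c..d}" "{c..d} \<subseteq> I"
      "\<And>r. r \<in> {c..d} \<Longrightarrow> \<bar>r - t\<bar> < e"
      using half_open_interval_cases[OF I(1) t e(1)] by metis
    have inN: "\<sigma> ` {c..d} \<subseteq> N" using cd e by auto
    then have img_V: "\<sigma> ` {c..d} \<subseteq> V" using N(3) by auto
    have c: "c \<in> {c..d}" "d \<in> {c..d}" "c \<in> I" "d \<in> I" using cd by auto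
    have V_c: "\<sigma> c \<in> V" "\<sigma> d \<in> V" using img_V c by auto
    have ne: "\<gamma> c \<noteq> \<gamma> d" using seg(2) c cd(1) I(2) by blast
    then have ne': "\<sigma> c \<noteq> \<sigma> d" using \<sigma> c by metis
    note lcd = len[OF cd(1,4)]
    have path: "causal_path_in X V (\<sigma> c) (\<sigma> d) c d \<sigma>"
      using lcd(1) img_V by (auto simp: causal_path_in_def)
    have "causal X (\<sigma> c) (\<sigma> d)" using lcd(1) cd(1) by (auto simp: directed_curve_def)
    then obtain a' b' \<alpha> where \<alpha>: "local_maximiser X V \<eta> (\<sigma> c) (\<sigma> d) a' b' \<alpha>"
      using V(2) V_c ne' unfolding localising_nbhd_def by blast
    then have \<alpha>p: "causal_path_in X V (\<sigma> c) (\<sigma> d) a' b' \<alpha>"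
      and \<alpha>l: "tau_length_on X a' b' \<alpha> = ennreal (\<eta> (\<sigma> c) (\<sigma> d))"
      by (auto simp: local_maximiser_def maximal_in_def)
    then have \<alpha>f: "future_causal X {a'..b'} \<alpha>" and \<alpha>e: "\<alpha> a' = \<sigma> c" "\<alpha> b' = \<sigma> d"
      by (auto simp: causal_path_in_def)
    have ab': "a' < b'" using \<alpha>p ne' by (rule causal_path_less)
    have "\<alpha> r \<in> N" if r: "r \<in> {a'..b'}" for r
    proof -
      have "r = a' \<or> r = b' \<or> causal X (\<alpha> a') (\<alpha> r) \<and> causal X (\<alpha> r) (\<alpha> b')"
        using \<alpha>f r by (fastforce simp: directed_curve_def)
      moreover have "\<alpha> r \<in> points X" using \<alpha>f r by (auto simp: directed_curve_def)
      moreover have "\<sigma> c \<in> N" "\<sigma> d \<in> N" using inN c by auto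
      ultimately show ?thesis using convex[of "\<sigma> c" "\<sigma> d" "\<alpha> r"] \<alpha>e by auto
    qed
    then have "\<iota> ` \<alpha> ` {a'..b'} \<subseteq> U" using N(3) unfolding P_def by blast
    then have pY: "causal_path_in Y U (\<gamma> c) (\<gamma> d) a' b' (\<iota> \<circ> \<alpha>)"
      using future_causal_image[OF \<alpha>f] \<alpha>e \<sigma> c by (auto simp: causal_path_in_def)
    have "ennreal (\<eta> (\<sigma> c) (\<sigma> d)) = tau_length_on Y a' b' (\<iota> \<circ> \<alpha>)"
      using length_eq[OF \<alpha>f] ab' \<alpha>l by (simp add: tau_length_compact)
    also have "\<dots> \<le> tau_length_on X c d \<sigma>"
      using tau_length_le_localising[OF pre_Y loc pY ne] lcd(2) by simp
    finally have "tau_length_on X c d \<sigma> = ennreal (\<eta> (\<sigma> c) (\<sigma> d))"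
      using tau_length_le_localising[OF pre_X V(2) path ne'] by simp
    then show "\<exists>U \<omega> c d e. localising_nbhd X U \<omega> \<and> \<sigma> t \<in> U \<and>
        c < d \<and> 0 < e \<and> I \<inter> ball t e \<subseteq> {c..d} \<and> {c..d} \<subseteq> I \<and>
        \<sigma> ` {c..d} \<subseteq> U \<and> tau_length_on X c d \<sigma> = ennreal (\<omega> (\<sigma> c) (\<sigma> d))"
      using V cd img_V by blast
  qed (rule timelike_imp_causal[OF pre_X tlX])
  then show "timelike_geodesic X I \<sigma>"
    using tlX by (simp add: timelike_geodesic_def timelike_curve_def)
  have nc: "\<not> compact I"
  proof
    assume "compact I"
    then have "Sup I \<in> I" "Inf I \<in> I"
      using I(3) by (auto intro!: closed_contains_Sup closed_contains_Inf compact_imp_closed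
          bounded_imp_bdd_above bounded_imp_bdd_below compact_imp_bounded)
    then show False using I(1,3) by auto
  qed
  have "tau_length_on X c d \<sigma> \<le> ennreal (\<omega> (\<gamma> a) (\<gamma> b))" if cd: "c \<in> I" "d \<in> I" "c < d" for c d
  proof -
    have ab: "a \<in> {a..b}" "b \<in> {a..b}" "c \<in> {a..b}" "d \<in> {a..b}" using cd I(2) by fastforce+
    then have mem: "\<gamma> a \<in> U" "\<gamma> b \<in> U" "\<gamma> c \<in> U" "\<gamma> d \<in> U" using img by blast+
    have "{c..d} \<subseteq> I" using I(1) cd by auto
    then have "tau_length_on X c d \<sigma> = ennreal (\<omega> (\<gamma> c) (\<gamma> d))" using len(2) cd(3) by blast
    also have "\<omega> (\<gamma> c) (\<gamma> d) \<le> \<omega> (\<gamma> a) (\<gamma> d)"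
      using localising_triangle[OF pre_Y loc, of "\<gamma> a" "\<gamma> c" "\<gamma> d"] localising_nonneg[OF pre_Y loc, of "\<gamma> a" "\<gamma> c"]
        localised_timelike_causal[OF pre_Y loc tl img] ab mem cd(3) by auto
    also have "\<omega> (\<gamma> a) (\<gamma> d) \<le> \<omega> (\<gamma> a) (\<gamma> b)"
      using localising_triangle[OF pre_Y loc, of "\<gamma> a" "\<gamma> d" "\<gamma> b"] localising_nonneg[OF pre_Y loc, of "\<gamma> d" "\<gamma> b"]
        localised_timelike_causal[OF pre_Y loc tl img] ab mem cd(3) by auto
    finally show ?thesis by (simp add: ennreal_leI)
  qed
  then have "tau_length X I \<sigma> \<le> ennreal (\<omega> (\<gamma> a) (\<gamma> b))"
    using nc unfolding tau_length_def by (auto intro!: SUP_least)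
  then show "tau_length X I \<sigma> \<noteq> \<infinity>" by (auto simp: top_unique)
qed

text \<open>Both \<open>\<gamma>\<close> and the image of \<open>\<gamma>'\<close> are continuous at \<open>s\<close>, and they agree up to a
  reparametrisation that takes values close to \<open>s\<close> at arguments close to \<open>s\<close>.\<close>

lemma endpoint_of_extension:
  assumes \<gamma>: "directed_curve Y R {a..b} \<gamma>" "insert s I \<subseteq> {a..b}"
    and \<gamma>': "directed_curve X R' (insert s I) \<gamma>'"
    and eq: "\<And>t. t \<in> I \<Longrightarrow> \<phi> t \<in> I \<and> \<iota> (\<gamma>' t) = \<gamma> (\<phi> t)"
    and approach: "\<And>e. e > 0 \<Longrightarrow> \<exists>t\<in>I. \<bar>t - s\<bar> < e \<and> \<bar>\<phi> t - s\<bar> < e"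
  shows "\<gamma> s = \<iota> (\<gamma>' s)"
proof (rule ccontr)
  have mX: "\<gamma>' t \<in> points X" if "t \<in> insert s I" for t using \<gamma>' that by (auto simp: directed_curve_def)
  have mY: "\<gamma> t \<in> points Y" if "t \<in> insert s I" for t
    using \<gamma> that by (auto simp: directed_curve_def image_subset_iff subset_iff)
  assume ne: "\<gamma> s \<noteq> \<iota> (\<gamma>' s)"
  have sY: "\<gamma> s \<in> points Y" "\<iota> (\<gamma>' s) \<in> points Y" using mX mY range by auto
  define \<epsilon> where "\<epsilon> = distance Y (\<gamma> s) (\<iota> (\<gamma>' s)) / 2"
  have "\<epsilon> > 0" using ne sY MY.mdist_pos_less by (simp add: \<epsilon>_def)
  have "s \<in> {a..b}" using \<gamma>(2) by auto
  from directed_curve_continuous[OF \<gamma>(1) this \<open>\<epsilon> > 0\<close>] obtain e where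
    e: "e > 0" "\<And>r. r \<in> {a..b} \<Longrightarrow> \<bar>r - s\<bar> < e \<Longrightarrow> distance Y (\<gamma> s) (\<gamma> r) < \<epsilon>" by metis
  from directed_curve_continuous[OF \<gamma>' insertI1 \<open>\<epsilon> > 0\<close>] obtain e' where
    e': "e' > 0" "\<And>r. r \<in> insert s I \<Longrightarrow> \<bar>r - s\<bar> < e' \<Longrightarrow> distance X (\<gamma>' s) (\<gamma>' r) < \<epsilon>" by metis
  obtain t where t: "t \<in> I" "\<bar>t - s\<bar> < min e e'" "\<bar>\<phi> t - s\<bar> < min e e'"
    using approach[of "min e e'"] e e' by auto
  have \<phi>t: "\<phi> t \<in> I" "\<iota> (\<gamma>' t) = \<gamma> (\<phi> t)" using eq t by auto
  have "distance Y (\<gamma> s) (\<gamma> (\<phi> t)) < \<epsilon>" using e(2)[of "\<phi> t"] \<phi>t t \<gamma>(2) by auto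
  moreover have "distance Y (\<iota> (\<gamma>' s)) (\<gamma> (\<phi> t)) < \<epsilon>"
    using e'(2)[of t] t isometry[of "\<gamma>' s" "\<gamma>' t"] mX \<phi>t by auto
  moreover have "distance Y (\<gamma> s) (\<iota> (\<gamma>' s)) \<le> distance Y (\<gamma> s) (\<gamma> (\<phi> t)) + distance Y (\<gamma> (\<phi> t)) (\<iota> (\<gamma>' s))"
    using sY mY \<phi>t by (intro MY.triangle) auto
  ultimately show False by (simp add: \<epsilon>_def MY.commute)
qed

end


section \<open>Reparametrisations near an open end\<close>

text \<open>A reparametrisation is monotone and onto, so it exceeds any given parameter from some point
  on. One \<open>t\<close> past that point and close to \<open>s\<close> serves both requirements.\<close>

lemma reparametrisation_approach_right:
  assumes "reparametrisation {a..<s} \<phi>" "a < s" "e > 0"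
  shows "\<exists>t\<in>{a..<s}. \<bar>t - s\<bar> < e \<and> \<bar>\<phi> t - s\<bar> < e"
proof -
  define u where "u = max a (s - e/2)"
  have u: "u \<in> {a..<s}" "s - u < e" using assms by (auto simp: u_def)
  then obtain t0 where t0: "t0 \<in> {a..<s}" "\<phi> t0 = u"
    using assms(1) unfolding reparametrisation_def by (metis imageE)
  define t where "t = max t0 u"
  have t: "t \<in> {a..<s}" "t0 \<le> t" "u \<le> t" using t0 u by (auto simp: t_def)
  then have "\<phi> t0 \<le> \<phi> t" "\<phi> t \<in> {a..<s}"
    using assms(1) t0(1) by (auto simp: reparametrisation_def strict_mono_on_leD)
  then show ?thesis using t u t0 by (intro bexI[of _ t]) auto
qed

lemma reparametrisation_approach_left:
  assumes "reparametrisation {s<..b} \<phi>" "s < b" "e > 0"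
  shows "\<exists>t\<in>{s<..b}. \<bar>t - s\<bar> < e \<and> \<bar>\<phi> t - s\<bar> < e"
proof -
  define u where "u = min b (s + e/2)"
  have u: "u \<in> {s<..b}" "u - s < e" using assms by (auto simp: u_def)
  then obtain t0 where t0: "t0 \<in> {s<..b}" "\<phi> t0 = u"
    using assms(1) unfolding reparametrisation_def by (metis imageE)
  define t where "t = min t0 u"
  have t: "t \<in> {s<..b}" "t \<le> t0" "t \<le> u" using t0 u by (auto simp: t_def)
  then have "\<phi> t \<le> \<phi> t0" "\<phi> t \<in> {s<..b}"
    using assms(1) t0(1) by (auto simp: reparametrisation_def strict_mono_on_leD)
  then show ?thesis using t u t0 by (intro bexI[of _ t]) auto
qed

section \<open>Crossing the frontier of an open set\<close>

lemma first_exit: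
  assumes "Metric_space (points Y) (distance Y)" "directed_curve Y R {a..b} \<gamma>" "a \<le> b"
    and W: "openin (top_of Y) W" "\<gamma> a \<in> W" "\<gamma> b \<notin> W"
  obtains s where "a < s" "s \<le> b" "\<gamma> s \<notin> W" "\<And>t. t \<in> {a..<s} \<Longrightarrow> \<gamma> t \<in> W"
proof -
  define S where "S = {t \<in> {a..b}. \<gamma> t \<notin> W}"
  define s where "s = Inf S"
  have S: "S \<noteq> {}" "bdd_below S" using assms by (auto simp: S_def)
  have s: "a \<le> s" "s \<le> b"
    using S assms(3) W(3) by (auto simp: s_def S_def intro!: cInf_greatest cInf_lower)
  have before: "\<gamma> t \<in> W" if "t \<in> {a..<s}" for t
  proof (rule ccontr)
    assume "\<gamma> t \<notin> W"
    then have "t \<in> S" using that s by (auto simp: S_def)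
    then have "s \<le> t" unfolding s_def using S(2) by (rule cInf_lower)
    then show False using that by auto
  qed
  have out: "\<gamma> s \<notin> W"
  proof
    assume "\<gamma> s \<in> W"
    with directed_curve_near[OF assms(1,2) _ W(1)] s obtain e where
      e: "e > 0" "\<And>r. r \<in> {a..b} \<Longrightarrow> \<bar>r - s\<bar> < e \<Longrightarrow> \<gamma> r \<in> W" by (metis atLeastAtMost_iff)
    obtain t where "t \<in> S" "t < s + e"
      using cInf_less_iff[OF S, of "s + e"] e(1) by (auto simp: s_def)
    moreover from this have "s \<le> t" unfolding s_def using S(2) by (intro cInf_lower)
    ultimately show False using e(2)[of t] by (auto simp: S_def)
  qed
  then have "a < s" using s W(2) by (cases "a = s") auto
  then show thesis using that s out before by blast
qed

lemma last_entry:
  assumes "Metric_space (points Y) (distance Y)" "directed_curve Y R {a..b} \<gamma>" "a \<le> b"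
    and W: "openin (top_of Y) W" "\<gamma> a \<notin> W" "\<gamma> b \<in> W"
  obtains s where "a \<le> s" "s < b" "\<gamma> s \<notin> W" "\<And>t. t \<in> {s<..b} \<Longrightarrow> \<gamma> t \<in> W"
proof -
  define S where "S = {t \<in> {a..b}. \<gamma> t \<notin> W}"
  define s where "s = Sup S"
  have S: "S \<noteq> {}" "bdd_above S" using assms by (auto simp: S_def)
  have s: "a \<le> s" "s \<le> b"
    using S assms(3) W(2) by (auto simp: s_def S_def intro!: cSup_least cSup_upper)
  have after: "\<gamma> t \<in> W" if "t \<in> {s<..b}" for t
  proof (rule ccontr)
    assume "\<gamma> t \<notin> W"
    then have "t \<in> S" using that s by (auto simp: S_def)
    then have "t \<le> s" unfolding s_def using S(2) by (rule cSup_upper)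
    then show False using that by auto
  qed
  have out: "\<gamma> s \<notin> W"
  proof
    assume "\<gamma> s \<in> W"
    with directed_curve_near[OF assms(1,2) _ W(1)] s obtain e where
      e: "e > 0" "\<And>r. r \<in> {a..b} \<Longrightarrow> \<bar>r - s\<bar> < e \<Longrightarrow> \<gamma> r \<in> W" by (metis atLeastAtMost_iff)
    obtain t where "t \<in> S" "s - e < t"
      using less_cSup_iff[OF S, of "s - e"] e(1) by (auto simp: s_def)
    moreover from this have "t \<le> s" unfolding s_def using S(2) by (intro cSup_upper)
    ultimately show False using e(2)[of t] by (auto simp: S_def)
  qed
  then have "s < b" using s W(3) by (cases "s = b") auto
  then show thesis using that s out after by blast
qed

text \<open>A localising neighbourhood contains a point \<open>y\<close> in the future of a frontier point \<open>p\<close>, and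
  \<open>p\<close> itself is not in the open set \<open>W\<close>. If \<open>y\<close> is in \<open>W\<close>, then \<open>p\<close> and \<open>y\<close> are separated by \<open>W\<close>.
  Otherwise \<open>p\<close> can be moved into \<open>W\<close> without leaving the open past of \<open>y\<close>.\<close>

lemma frontier_crossing_chron:
  assumes pre: "lorentzian_pre_length_space Y" and "connected_space (top_of Y)"
    and reg: "regularly_localisable Y"
    and W: "openin (top_of Y) W" "W \<noteq> {}" "W \<subset> points Y"
  obtains U \<omega> x y where "regular_localising_nbhd Y U \<omega>" "x \<in> U" "y \<in> U" "chron Y x y"
    "x \<in> W \<longleftrightarrow> y \<notin> W"
proof -
  interpret Metric_space "points Y" "distance Y"
    using pre by (simp add: lorentzian_pre_length_space_def)
  have "\<not> closedin mtopology W"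
    using assms(2) W by (auto simp: connected_space_clopen_in)
  then have "\<not> mtopology closure_of W \<subseteq> W"
    using W(3) closure_of_subset_eq[of W mtopology] by auto
  then obtain p where p: "p \<in> mtopology closure_of W" "p \<notin> W" by auto
  then have "p \<in> points Y" by (auto simp: in_closure_of)
  then obtain U \<omega> where U: "p \<in> U" "regular_localising_nbhd Y U \<omega>"
    using reg by (auto simp: regularly_localisable_def)
  then have loc: "localising_nbhd Y U \<omega>" by (simp add: regular_localising_nbhd_def)
  then obtain y where y: "y \<in> U" "y \<in> points Y" "chron Y p y"
    using U(1) unfolding localising_nbhd_def chron_future_def by blast
  show thesis
  proof (cases "y \<in> W")
    case True
    then show thesis using that U y p(2) by blast
  next
    case False
    have "openin mtopology (chron_past Y y \<inter> U)"
      using openin_chron_past[OF pre y(2)] loc by (auto simp: localising_nbhd_def)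
    moreover have "p \<in> chron_past Y y \<inter> U" using U y \<open>p \<in> points Y\<close> by (auto simp: chron_past_def)
    ultimately obtain x where "x \<in> W" "x \<in> chron_past Y y \<inter> U" using p(1) by (meson in_closure_of)
    then show thesis using that[of U \<omega> x y] U y False by (auto simp: chron_past_def)
  qed
qed

section \<open>Timelike completeness and inextendibility\<close>

theorem theorem5p3:
  fixes X :: "'a lorentzian_structure"
  assumes "points X \<noteq> {}"
    and "lorentzian_length_space X"
    and "strongly_causal X"
    and "property_TC X"
  shows "\<nexists>Y :: 'b lorentzian_structure. regular_lorentzian_length_space Y \<and> is_extension Y X"
proof clarify
  fix Y :: "'b lorentzian_structure"
  assume Y: "regular_lorentzian_length_space Y" and ext: "is_extension Y X"
  have pre_X: "lorentzian_pre_length_space X" and lX: "localisable X"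
    using assms(2) by (auto simp: lorentzian_length_space_def)
  have pre_Y: "lorentzian_pre_length_space Y" and reg: "regularly_localisable Y"
    using Y by (auto simp: regular_lorentzian_length_space_def lorentzian_length_space_def)
  obtain \<iota> where W: "openin (top_of Y) (\<iota> ` points X)" "\<iota> ` points X \<subset> points Y"
    and preserve: "\<forall>x\<in>points X. \<forall>y\<in>points X.
           distance Y (\<iota> x) (\<iota> y) = distance X x y \<and>
           (causal X x y \<longrightarrow> causal Y (\<iota> x) (\<iota> y)) \<and>
           (chron X x y \<longrightarrow> chron Y (\<iota> x) (\<iota> y))"
    and curves: "\<forall>I \<gamma>. is_interval I \<and> \<gamma> ` I \<subseteq> points X \<longrightarrow>
           (timelike_curve X I \<gamma> \<longleftrightarrow> timelike_curve Y I (\<iota> \<circ> \<gamma>)) \<and>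
           (causal_curve X I \<gamma> \<longleftrightarrow> causal_curve Y I (\<iota> \<circ> \<gamma>))"
    and lengths: "\<forall>I \<gamma>. future_causal X I \<gamma> \<longrightarrow> tau_length X I \<gamma> = tau_length Y I (\<iota> \<circ> \<gamma>)"
    using ext unfolding is_extension_def by (elim conjE exE) (rule that)
  interpret extension X Y \<iota>
  proof
    show "\<iota> ` points X \<subseteq> points Y" using W(2) by (rule psubset_imp_subset)
  qed (use pre_X pre_Y preserve curves lengths in blast)+
  define W where "W = \<iota> ` points X"
  define \<sigma> where "\<sigma> \<gamma> t = inv_into (points X) \<iota> (\<gamma> t)" for \<gamma> :: "real \<Rightarrow> 'b" and t
  have \<sigma>: "\<sigma> \<gamma> t \<in> points X \<and> \<iota> (\<sigma> \<gamma> t) = \<gamma> t" if "\<gamma> t \<in> W" for \<gamma> t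
    using that by (auto simp: \<sigma>_def W_def f_inv_into_f inv_into_into)
  obtain U \<omega> x y where U: "regular_localising_nbhd Y U \<omega>" "x \<in> U" "y \<in> U" "chron Y x y"
    and xy: "x \<in> W \<longleftrightarrow> y \<notin> W"
    using frontier_crossing_chron[OF pre_Y _ reg W(1)] ext W(2) assms(1)
    unfolding W_def is_extension_def by (metis image_is_empty)
  then have loc: "localising_nbhd Y U \<omega>" by (simp add: regular_localising_nbhd_def)
  obtain a b \<gamma> where "local_maximiser Y U \<omega> x y a b \<gamma>" and tl: "future_timelike Y {a..b} \<gamma>"
    using U unfolding regular_localising_nbhd_def by blast
  then have img: "\<gamma> ` {a..b} \<subseteq> U" and ends: "\<gamma> a = x" "\<gamma> b = y"
    and max: "tau_length_on Y a b \<gamma> = ennreal (\<omega> (\<gamma> a) (\<gamma> b))"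
    by (auto simp: local_maximiser_def maximal_in_def causal_path_in_def)
  have ab: "a \<le> b" using tl by (auto simp: directed_curve_def)
  note pull = pullback_maximiser[OF assms(3) lX loc tl img max]
  show False
  proof (cases "x \<in> W")
    case True
    obtain s where s: "a < s" "s \<le> b" "\<gamma> s \<notin> W" and before: "\<And>t. t \<in> {a..<s} \<Longrightarrow> \<gamma> t \<in> W"
      using first_exit[OF MY.Metric_space_axioms tl ab W(1)] True xy ends unfolding W_def by metis
    let ?I = "{a..<s}"
    have I: "?I = {a..<s} \<or> ?I = {s<..b}" "?I \<subseteq> {a..b}" "?I \<noteq> {}" "insert s ?I = {a..s}"
      using s by auto
    have "future_inextendible X a s (\<sigma> \<gamma>)"
      unfolding future_inextendible_def
    proof (intro allI impI notI)
      fix \<phi> assume \<phi>: "reparametrisation ?I \<phi>" and "future_extendible X a s (\<sigma> \<gamma> \<circ> \<phi>)"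
      then obtain \<gamma>' where \<gamma>': "future_causal X (insert s ?I) \<gamma>'" "\<forall>t\<in>?I. \<gamma>' t = \<sigma> \<gamma> (\<phi> t)"
        by (auto simp: future_extendible_def geodesic_def I(4))
      have "\<phi> t \<in> ?I" if "t \<in> ?I" for t using \<phi> that unfolding reparametrisation_def by blast
      then have "\<gamma> s = \<iota> (\<gamma>' s)"
        using \<gamma>'(2) \<sigma> before s I reparametrisation_approach_right[OF \<phi> s(1)]
        by (intro endpoint_of_extension[OF tl _ \<gamma>'(1), of \<phi>]) auto
      moreover have "\<gamma>' s \<in> points X" using \<gamma>'(1) by (auto simp: directed_curve_def)
      ultimately show False using s(3) by (simp add: W_def)
    qed
    moreover have "timelike_geodesic X ?I (\<sigma> \<gamma>)" "tau_length X ?I (\<sigma> \<gamma>) \<noteq> \<infinity>"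
      using pull[OF I(1-3), of "\<sigma> \<gamma>"] \<sigma> before by blast+
    ultimately show False using assms(4) unfolding property_TC_def by blast
  next
    case False
    obtain s where s: "a \<le> s" "s < b" "\<gamma> s \<notin> W" and after: "\<And>t. t \<in> {s<..b} \<Longrightarrow> \<gamma> t \<in> W"
      using last_entry[OF MY.Metric_space_axioms tl ab W(1)] False xy ends unfolding W_def by metis
    let ?I = "{s<..b}"
    have I: "?I = {a..<s} \<or> ?I = {s<..b}" "?I \<subseteq> {a..b}" "?I \<noteq> {}" "insert s ?I = {s..b}"
      using s by auto
    have "past_inextendible X s b (\<sigma> \<gamma>)"
      unfolding past_inextendible_def
    proof (intro allI impI notI)
      fix \<phi> assume \<phi>: "reparametrisation ?I \<phi>" and "past_extendible X s b (\<sigma> \<gamma> \<circ> \<phi>)"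
      then obtain \<gamma>' where \<gamma>': "future_causal X (insert s ?I) \<gamma>'" "\<forall>t\<in>?I. \<gamma>' t = \<sigma> \<gamma> (\<phi> t)"
        by (auto simp: past_extendible_def geodesic_def I(4))
      have "\<phi> t \<in> ?I" if "t \<in> ?I" for t using \<phi> that unfolding reparametrisation_def by blast
      then have "\<gamma> s = \<iota> (\<gamma>' s)"
        using \<gamma>'(2) \<sigma> after s I reparametrisation_approach_left[OF \<phi> s(2)]
        by (intro endpoint_of_extension[OF tl _ \<gamma>'(1), of \<phi>]) auto
      moreover have "\<gamma>' s \<in> points X" using \<gamma>'(1) by (auto simp: directed_curve_def)
      ultimately show False using s(3) by (simp add: W_def)
    qed
    moreover have "timelike_geodesic X ?I (\<sigma> \<gamma>)" "tau_length X ?I (\<sigma> \<gamma>) \<noteq> \<infinity>"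
      using pull[OF I(1-3), of "\<sigma> \<gamma>"] \<sigma> after by blast+
    ultimately show False using assms(4) unfolding property_TC_def by blast
  qed
qed

end
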